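(* Let $\mu$ be a finite positive Borel measure on $\mathbb{R}^d$, and let $\Lambda\subset\mathbb{R}^d$ be a countable set such that $E(\Lambda)=\{e^{2\pi i\lambda\cdot x}:\lambda\in\Lambda\}$ is a Bessel sequence of $\mu$, namely for some $B>0$, $$\sum_{\lambda\in\Lambda}\left|\int f(x)e^{-2\pi i\lambda\cdot x}\,d\mu(x)\right|^2\le B\int|f(x)|^2\,d\mu(x)\qquad\text{for all } f\in L^2(\mu).$$ Suppose there exist $r,L,\gamma,c>0$ such that for any $\lambda\in\Lambda$ with $|\lambda|>L$, $$|\lambda|^{\gamma}\int_{B_r(\lambda)}|\widehat{\mu}(\xi)|^2\,d\xi>c>0.$$ Then $$\sum_{\lambda\in\Lambda\setminus\{0\}}\frac{1}{|\lambda|^{\gamma}}<\infty.$$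
   Context: The Fourier transform of a finite Borel measure $\mu$ on $\mathbb{R}^d$ is $\widehat{\mu}(\xi)=\int e^{-2\pi i\xi\cdot x}\,d\mu(x)$. $B_r(\lambda)$ denotes the Euclidean ball of radius $r$ centered at $\lambda$.
   Formalization: The measure μ is additionally assumed to be nonzero; for μ = 0 the claim fails, e.g. for Λ = {e/n : n ≥ 1} with |e| = 1 and L = 2, where the hypotheses hold trivially but the sum diverges. *)

theory Defs
  imports "HOL-Analysis.Analysis"
begin

definition exponential :: "'a::euclidean_space \<Rightarrow> 'a \<Rightarrow> complex" where
  "exponential \<xi> x = exp (2 * of_real pi * \<i> * of_real (\<xi> \<bullet> x))"

definition fourier_transform :: "'a::euclidean_space measure \<Rightarrow> 'a \<Rightarrow> complex" where
  "fourier_transform \<mu> \<xi> = (LINT x|\<mu>. exponential (- \<xi>) x)"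

definition square_integrable :: "'a measure \<Rightarrow> ('a \<Rightarrow> complex) \<Rightarrow> bool" where
  "square_integrable \<mu> f \<longleftrightarrow>
     f \<in> borel_measurable \<mu> \<and> integrable \<mu> (\<lambda>x. (cmod (f x))\<^sup>2)"

text \<open>The summability conjunct is needed because \<^const>\<open>infsum\<close> is 0 on families that
  are not summable.\<close>

definition bessel_exponentials :: "'a::euclidean_space measure \<Rightarrow> 'a set \<Rightarrow> bool" where
  "bessel_exponentials \<mu> \<Lambda> \<longleftrightarrow>
     (\<exists>B>0. \<forall>f. square_integrable \<mu> f \<longrightarrow>
        (\<lambda>l. (cmod (LINT x|\<mu>. f x * exponential (- l) x))\<^sup>2) summable_on \<Lambda> \<and>
        (\<Sum>\<^sub>\<infinity>l\<in>\<Lambda>. (cmod (LINT x|\<mu>. f x * exponential (- l) x))\<^sup>2)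
          \<le> B * (LINT x|\<mu>. (cmod (f x))\<^sup>2))"

end

theory Submission
  imports Defs
begin

text \<open>Testing the Bessel inequality on a single exponential of frequency \<open>\<eta>\<close> bounds the sum over
  \<open>\<lambda> \<in> \<Lambda>\<close> of \<open>|FT(\<lambda> - \<eta>)|\<^sup>2\<close> uniformly in \<open>\<eta>\<close>, where \<open>FT\<close> is the Fourier transform of \<open>\<mu>\<close>.
  Averaging over \<open>\<eta>\<close> in the ball of radius \<open>r\<close> about 0 bounds the sum of the integrals of \<open>|FT|\<^sup>2\<close>
  over the balls \<open>B\<^sub>r(\<lambda>)\<close>, which dominates the tail of the series. Only finitely many
  \<open>\<lambda>\<close> remain: near an accumulation point \<open>\<eta>\<close> of \<open>\<Lambda>\<close> infinitely many summands \<open>|FT(\<lambda> - \<eta>)|\<^sup>2\<close>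
  would be close to \<open>|FT(0)|\<^sup>2 > 0\<close>.\<close>

lemma norm_exponential [simp]: "cmod (exponential \<xi> x) = 1"
  by (simp add: exponential_def)

lemma exponential_mult: "exponential \<xi> x * exponential \<eta> x = exponential (\<xi> + \<eta>) x"
  by (simp add: exponential_def exp_add [symmetric] algebra_simps)

lemma continuous_on_exponential: "continuous_on A (exponential \<xi>)"
  unfolding exponential_def by (intro continuous_intros)

lemma continuous_on_exponential_frequency: "continuous_on A (\<lambda>\<xi>. exponential \<xi> x)"
  unfolding exponential_def by (intro continuous_intros)

lemma measurable_exponential:
  assumes "sets \<mu> = sets borel"
  shows "exponential \<xi> \<in> borel_measurable \<mu>"
  using borel_measurable_continuous_onI [OF continuous_on_exponential] assms
  by (simp cong: measurable_cong_sets)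

text \<open>Lebesgue measure is translation invariant; this moves the integrals over all balls
  \<open>ball l r\<close> to the common domain \<open>ball 0 r\<close>, where they can be
  added.\<close>

lemma set_lebesgue_integral_ball_translate:
  fixes f :: "'a::euclidean_space \<Rightarrow> real"
  assumes "f \<in> borel_measurable borel"
  shows "(LBINT x:ball a r. f x) = (LBINT x:ball 0 r. f (a + x))"
proof -
  have "(LBINT x:ball a r. f x) =
      (LINT x|distr lborel borel ((+) a). indicator (ball a r) x *\<^sub>R f x)"
    by (simp add: set_lebesgue_integral_def lborel_distr_plus)
  also have "\<dots> = (LBINT x. indicator (ball a r) (a + x) *\<^sub>R f (a + x))"
    by (intro integral_distr borel_measurable_scaleR borel_measurable_indicator) (auto simp: assms)
  also have "\<dots> = (LBINT x:ball 0 r. f (a + x))"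
    by (simp add: set_lebesgue_integral_def indicator_def dist_norm)
  finally show ?thesis .
qed

context
  fixes M :: "'a::euclidean_space measure"
  assumes finite: "finite_measure M" and sets: "sets M = sets borel"
begin

interpretation finite_measure M by (rule finite)

lemma fourier_transform_0: "fourier_transform M 0 = measure M (space M)"
  by (simp add: fourier_transform_def exponential_def scaleR_conv_of_real)

lemma norm_fourier_transform_le: "cmod (fourier_transform M \<xi>) \<le> measure M (space M)"
proof -
  have "cmod (fourier_transform M \<xi>) \<le> (LINT x|M. cmod (exponential (- \<xi>) x))"
    unfolding fourier_transform_def by (rule integral_norm_bound)
  then show ?thesis by simp
qed

lemma continuous_on_fourier_transform: "continuous_on A (fourier_transform M)"
proof (rule continuous_on_sequentiallyI)
  fix u :: "nat \<Rightarrow> 'a" and a assume "u \<longlonglongrightarrow> a"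
  show "(\<lambda>n. fourier_transform M (u n)) \<longlonglongrightarrow> fourier_transform M a"
    unfolding fourier_transform_def
  \<comment> \<open>Exponentials have modulus 1, and the constant 1 is integrable because
    \<open>M\<close> is finite.\<close>
  proof (rule integral_dominated_convergence [where w = "\<lambda>_. 1"])
    show "AE x in M. (\<lambda>n. exponential (- u n) x) \<longlonglongrightarrow> exponential (- a) x"
      using continuous_on_tendsto_compose
        [OF continuous_on_exponential_frequency [of UNIV] tendsto_minus [OF \<open>u \<longlonglongrightarrow> a\<close>]]
      by (intro AE_I2) simp
  qed (auto simp: measurable_exponential [OF sets])
qed

text \<open>The test function \<open>exponential \<eta>\<close> has squared norm
  \<open>measure M (space M)\<close> for every \<eta>, so one \<open>K\<close> serves all shifts.
  Finite partial sums suffice below and can be exchanged with integrals directly.\<close>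

lemma bessel_exponentials_fourier_transform:
  assumes "bessel_exponentials M \<Lambda>"
  obtains K where
    "\<And>\<eta> F. finite F \<Longrightarrow> F \<subseteq> \<Lambda> \<Longrightarrow> (\<Sum>l\<in>F. (cmod (fourier_transform M (l - \<eta>)))\<^sup>2) \<le> K"
proof -
  obtain B where B: "\<And>f. square_integrable M f \<Longrightarrow>
        (\<lambda>l. (cmod (LINT x|M. f x * exponential (- l) x))\<^sup>2) summable_on \<Lambda> \<and>
        (\<Sum>\<^sub>\<infinity>l\<in>\<Lambda>. (cmod (LINT x|M. f x * exponential (- l) x))\<^sup>2)
          \<le> B * (LINT x|M. (cmod (f x))\<^sup>2)"
    using assms unfolding bessel_exponentials_def by blast
  show ?thesis
  proof
    fix \<eta> F assume F: "finite F" "F \<subseteq> \<Lambda>"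
    have FT: "(LINT x|M. exponential \<eta> x * exponential (- l) x) = fourier_transform M (l - \<eta>)" for l
      by (simp add: exponential_mult fourier_transform_def)
    have "square_integrable M (exponential \<eta>)"
      by (simp add: square_integrable_def measurable_exponential [OF sets])
    from B [OF this] have
      "(\<lambda>l. (cmod (fourier_transform M (l - \<eta>)))\<^sup>2) summable_on \<Lambda>"
      "(\<Sum>\<^sub>\<infinity>l\<in>\<Lambda>. (cmod (fourier_transform M (l - \<eta>)))\<^sup>2) \<le> B * measure M (space M)"
      by (simp_all add: FT)
    with finite_sum_le_infsum [OF this(1) F]
    show "(\<Sum>l\<in>F. (cmod (fourier_transform M (l - \<eta>)))\<^sup>2) \<le> B * measure M (space M)"
      by simp
  qed
qed

lemma bessel_exponentials_locally_finite:
  assumes pos: "measure M (space M) > 0"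
    and bessel: "bessel_exponentials M \<Lambda>" and "bounded S"
  shows "finite (\<Lambda> \<inter> S)"
proof (rule ccontr)
  assume "infinite (\<Lambda> \<inter> S)"
  moreover have "compact (closure S)"
    using \<open>bounded S\<close> by simp
  ultimately obtain a where "a islimpt (\<Lambda> \<inter> S)"
    using closure_subset [of S] by (meson Heine_Borel_imp_Bolzano_Weierstrass le_infI2)
  define m where "m = measure M (space M)"
  have "isCont (fourier_transform M) 0"
    using continuous_on_fourier_transform [of UNIV]
    by (simp add: continuous_on_eq_continuous_at)
  \<comment> \<open>Since the transform equals \<open>m > 0\<close> at 0, it has modulus at least
    \<open>m / 2\<close> within distance \<open>d\<close> of 0.\<close>
  then obtain d where "d > 0" and d: "\<And>\<xi>. norm \<xi> < d \<Longrightarrow> cmod (fourier_transform M \<xi> - m) < m / 2"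
    using pos unfolding continuous_at_eps_delta m_def fourier_transform_0 [symmetric]
    by (metis dist_norm diff_zero half_gt_zero)
  have inf: "infinite (\<Lambda> \<inter> S \<inter> ball a d)"
    using \<open>a islimpt (\<Lambda> \<inter> S)\<close> \<open>d > 0\<close> by (simp add: islimpt_eq_infinite_ball)
  \<comment> \<open>The bound holds for every shift, so it applies with \<eta> = \<open>a\<close>,
    although the limit point \<open>a\<close> may lie outside \<Lambda>.\<close>
  obtain K where K: "\<And>\<eta> F. finite F \<Longrightarrow> F \<subseteq> \<Lambda> \<Longrightarrow>
      (\<Sum>l\<in>F. (cmod (fourier_transform M (l - \<eta>)))\<^sup>2) \<le> K"
    using bessel_exponentials_fourier_transform [OF bessel] by blast
  \<comment> \<open>Each point of \<Lambda> near \<open>a\<close> contributes at least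
    \<open>(m / 2)\<^sup>2\<close>, so \<open>n\<close> of them exceed \<open>K\<close>.\<close>
  obtain n :: nat where n: "n * (m / 2)\<^sup>2 > K"
    using reals_Archimedean3 [of "(m / 2)\<^sup>2"] pos by (auto simp: m_def)
  obtain F where F: "finite F" "card F = n" "F \<subseteq> \<Lambda> \<inter> S \<inter> ball a d"
    using infinite_arbitrarily_large [OF inf] by blast
  have "n * (m / 2)\<^sup>2 = (\<Sum>l\<in>F. (m / 2)\<^sup>2)"
    using F by simp
  also have "\<dots> \<le> (\<Sum>l\<in>F. (cmod (fourier_transform M (l - a)))\<^sup>2)"
  proof (intro sum_mono power_mono)
    fix l assume "l \<in> F"
    then have "norm (l - a) < d"
      using F by (auto simp: dist_norm norm_minus_commute)
    from d [OF this] show "m / 2 \<le> cmod (fourier_transform M (l - a))"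
      using norm_triangle_ineq2 [of "of_real m" "of_real m - fourier_transform M (l - a)"]
      by (simp add: norm_minus_commute)
  qed (simp add: m_def)
  also have "\<dots> \<le> K"
    using F by (intro K) auto
  finally show False
    using n by simp
qed

text \<open>After translation the finite sum passes under a single integral over
  \<open>ball 0 r\<close>, whose integrand is at most \<open>K\<close> pointwise; \<open>C\<close>
  is the integral of \<open>K\<close> over that ball.\<close>

lemma bessel_exponentials_sum_ball_integrals:
  assumes bessel: "bessel_exponentials M \<Lambda>"
  obtains C where "\<And>F. finite F \<Longrightarrow> F \<subseteq> \<Lambda> \<Longrightarrow>
    (\<Sum>l\<in>F. LBINT \<xi>:ball l r. (cmod (fourier_transform M \<xi>))\<^sup>2) \<le> C"
proof -
  obtain K where K: "\<And>\<eta> F. finite F \<Longrightarrow> F \<subseteq> \<Lambda> \<Longrightarrow>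
      (\<Sum>l\<in>F. (cmod (fourier_transform M (l - \<eta>)))\<^sup>2) \<le> K"
    using bessel_exponentials_fourier_transform [OF bessel] by blast
  have [measurable]: "fourier_transform M \<in> borel_measurable borel"
    by (intro borel_measurable_continuous_onI continuous_on_fourier_transform)
  have fin: "emeasure lborel (ball (0::'a) r) < \<infinity>"
    by (intro emeasure_bounded_finite bounded_ball)
  have int: "set_integrable lborel (ball 0 r) (\<lambda>\<eta>. (cmod (fourier_transform M (l + \<eta>)))\<^sup>2)" for l
    unfolding set_integrable_def
    \<comment> \<open>The squared transform is bounded by the squared total mass, on a set of finite
      volume.\<close>
    by (rule integrableI_bounded_set_indicator [where B = "(measure M (space M))\<^sup>2"])
      (use fin in \<open>auto intro!: AE_I2 power_mono norm_fourier_transform_le\<close>)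
  show ?thesis
  proof
    fix F assume F: "finite F" "F \<subseteq> \<Lambda>"
    have "(\<Sum>l\<in>F. LBINT \<xi>:ball l r. (cmod (fourier_transform M \<xi>))\<^sup>2)
        = (\<Sum>l\<in>F. LBINT \<eta>:ball 0 r. (cmod (fourier_transform M (l + \<eta>)))\<^sup>2)"
      by (intro sum.cong refl set_lebesgue_integral_ball_translate) measurable
    also have "\<dots> = (LBINT \<eta>:ball 0 r. \<Sum>l\<in>F. (cmod (fourier_transform M (l + \<eta>)))\<^sup>2)"
      using int unfolding set_lebesgue_integral_def set_integrable_def scaleR_sum_right
      by (intro Bochner_Integration.integral_sum [symmetric])
    also have "\<dots> \<le> (LBINT \<eta>:ball (0::'a) r. K)"
    proof (rule set_integral_mono)
      show "set_integrable lborel (ball 0 r) (\<lambda>\<eta>. \<Sum>l\<in>F. (cmod (fourier_transform M (l + \<eta>)))\<^sup>2)"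
        using int unfolding set_integrable_def scaleR_sum_right
        by (intro Bochner_Integration.integrable_sum)
      show "set_integrable lborel (ball (0::'a) r) (\<lambda>_. K)"
        using fin unfolding set_integrable_def
        by (intro integrable_scaleR_left) simp
      show "(\<Sum>l\<in>F. (cmod (fourier_transform M (l + \<eta>)))\<^sup>2) \<le> K" for \<eta>
        using K [OF F, of "- \<eta>"] by simp
    qed
    finally show "(\<Sum>l\<in>F. LBINT \<xi>:ball l r. (cmod (fourier_transform M \<xi>))\<^sup>2)
        \<le> (LBINT \<eta>:ball (0::'a) r. K)" .
  qed
qed

end

text \<open>The zero measure has to be excluded: every \<Lambda> is Bessel for it, and an infinite
  \<Lambda> inside \<open>cball 0 L\<close> satisfies the lower bound vacuously while its series
  diverges.\<close>

theorem theorem1p4: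
  fixes \<mu> :: "'a::euclidean_space measure"
    and \<Lambda> :: "'a set"
    and r L \<gamma> c :: real
  assumes "finite_measure \<mu>"
    and "sets \<mu> = sets borel"
    and "emeasure \<mu> UNIV \<noteq> 0"
    and "countable \<Lambda>"
    and "bessel_exponentials \<mu> \<Lambda>"
    and "r > 0" and "L > 0" and "\<gamma> > 0" and "c > 0"
    and "\<And>l. l \<in> \<Lambda> \<Longrightarrow> norm l > L \<Longrightarrow>
           norm l powr \<gamma> * (LBINT \<xi>:ball l r. (cmod (fourier_transform \<mu> \<xi>))\<^sup>2) > c"
  shows "(\<lambda>l. 1 / norm l powr \<gamma>) summable_on (\<Lambda> - {0})"
proof -
  interpret finite_measure \<mu> by fact
  define I where "I = (\<lambda>l. LBINT \<xi>:ball l r. (cmod (fourier_transform \<mu> \<xi>))\<^sup>2)"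
  obtain C where C: "\<And>F. finite F \<Longrightarrow> F \<subseteq> \<Lambda> \<Longrightarrow> sum I F \<le> C"
    using bessel_exponentials_sum_ball_integrals [OF assms(1,2,5), of r] unfolding I_def by blast
  have "space \<mu> = UNIV"
    using sets_eq_imp_space_eq [OF assms(2)] by simp
  then have "measure \<mu> (space \<mu>) > 0"
    using assms(3) by (simp add: emeasure_eq_measure zero_less_measure_iff)
  then have "finite (\<Lambda> \<inter> cball 0 L)"
    by (rule bessel_exponentials_locally_finite [OF assms(1,2) _ assms(5) bounded_cball])
  then have near: "(\<lambda>l. 1 / norm l powr \<gamma>) summable_on (\<Lambda> \<inter> cball 0 L - {0})"
    by (intro summable_on_finite) auto
  have far: "(\<lambda>l. 1 / norm l powr \<gamma>) summable_on (\<Lambda> - cball 0 L)"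
  \<comment> \<open>The terms are nonnegative, so a common bound on the finite partial sums is
    enough.\<close>
  proof (intro nonneg_bdd_above_summable_on bdd_aboveI2)
    fix F assume "F \<in> {F. F \<subseteq> \<Lambda> - cball 0 L \<and> finite F}"
    then have F: "F \<subseteq> \<Lambda> - cball 0 L" "finite F" by auto
    have "(\<Sum>l\<in>F. 1 / norm l powr \<gamma>) \<le> (\<Sum>l\<in>F. I l / c)"
    proof (rule sum_mono)
      fix l assume "l \<in> F"
      with F have "l \<in> \<Lambda>" "norm l > L" by auto
      then have "norm l powr \<gamma> * I l > c" "norm l powr \<gamma> > 0"
        using assms(10) [of l] \<open>L > 0\<close> by (auto simp: I_def)
      with \<open>c > 0\<close> show "1 / norm l powr \<gamma> \<le> I l / c"
        by (simp add: divide_simps mult.commute)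
    qed
    also have "\<dots> \<le> C / c"
      unfolding sum_divide_distrib [symmetric]
      using F \<open>c > 0\<close> by (intro divide_right_mono C) auto
    finally show "(\<Sum>l\<in>F. 1 / norm l powr \<gamma>) \<le> C / c" .
  qed simp
  \<comment> \<open>As \<open>L > 0\<close>, the origin lies in \<open>cball 0 L\<close>, so
    removing it affects only the finite part.\<close>
  have "\<Lambda> - {0} = (\<Lambda> \<inter> cball 0 L - {0}) \<union> (\<Lambda> - cball 0 L)"
    using \<open>L > 0\<close> by auto
  then show ?thesis
    using near far by (simp add: summable_on_Un_disjoint Int_Diff disjoint_iff)
qed

end
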